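(* Let $q\ge 3$ be an integer and let $a$ be an integer coprime to $q$. Let $c_\pi(q)$ and $x_\pi(q)$ be the positive constants described in the context. Suppose that $c_\pi(q)\varphi(q)<1$. Then for every positive integer $n$, either $p_n(q,a)\le x_\pi(q)$ or $$n\varphi(q)\log(n\varphi(q))<p_n(q,a)<n\varphi(q)\Big(\log(n\varphi(q))+\tfrac43\log\log(n\varphi(q))\Big).$$
   Context: $\varphi$ is Euler's totient function, $\log$ is the natural logarithm, $p_n(q,a)$ is the $n$th smallest prime congruent to $a$ modulo $q$, $\pi(x;q,a)$ is the number of primes $p\le x$ with $p\equiv a\pmod q$, and $\operatorname{Li}(x)=\int_2^x\frac{dt}{\log t}$. Constants $c_\pi(q),x_\pi(q)$: for each integer $q\ge3$ these are fixed explicit positive constants with the property that, for every integer $b$ coprime to $q$, $$\left|\pi(x;q,b)-\frac{\operatorname{Li}(x)}{\varphi(q)}\right|<c_\pi(q)\,\frac{x}{(\log x)^2}\qquad\text{for all }x\ge x_\pi(q).$$ For $q>10^5$ they are $c_\pi(q)=\frac1{160}$ and $x_\pi(q)=\exp(0.03\sqrt q(\log q)^3)$; for $3\le q\le10^5$ they are tabulated numerical constants with $c_\pi(q)\le\frac1{840}$ if $q\le 10^4$, $c_\pi(q)\le\frac1{160}$ if $q>10^4$, and $x_\pi(q)\le 8\cdot10^9$ being the smallest positive real number for which the displayed inequality holds for all $x\ge x_\pi(q)$ and all $b$ coprime to $q$. These constants satisfy $x_\pi(q)\ge 14735$ for all $q\ge3$. *)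

theory Defs
  imports
    "HOL-Analysis.Analysis"
    "HOL-Number_Theory.Number_Theory"
    "HOL-Library.Infinite_Set"
begin

definition primes_ap :: "nat \<Rightarrow> int \<Rightarrow> nat set" where
  "primes_ap q a = {p. prime p \<and> [int p = a] (mod int q)}"

definition prime_count_ap :: "real \<Rightarrow> nat \<Rightarrow> int \<Rightarrow> nat" where
  "prime_count_ap x q a = card {p \<in> primes_ap q a. real p \<le> x}"

(* Indexed from n = 1, whereas enumerate starts at 0.  Meaningful as soon as primes_ap q a has
   at least n elements; under the counting estimate below it is infinite for a coprime to q. *)
definition nth_prime_ap :: "nat \<Rightarrow> nat \<Rightarrow> int \<Rightarrow> nat" where
  "nth_prime_ap n q a = enumerate (primes_ap q a) (n - 1)"

definition Li :: "real \<Rightarrow> real" where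
  "Li x = (LBINT t=2..x. 1 / ln t)"

definition pi_estimate_from :: "nat \<Rightarrow> real \<Rightarrow> real \<Rightarrow> bool" where
  "pi_estimate_from q c x0 \<longleftrightarrow>
     (\<forall>b. coprime b (int q) \<longrightarrow>
       (\<forall>x\<ge>x0. \<bar>real (prime_count_ap x q b) - Li x / real (totient q)\<bar> < c * (x / (ln x)\<^sup>2)))"

(* The values c = c_pi(q) and x0 = x_pi(q) for one modulus q >= 3.  For q <= 10^5 they come from
   numerical tables and enter only through the properties known of them: c is a positive number
   subject to an upper bound, and x0 is the least threshold belonging to that c. *)
definition pi_constants :: "nat \<Rightarrow> real \<Rightarrow> real \<Rightarrow> bool" where
  "pi_constants q c x0 \<longleftrightarrow>
     0 < c \<and> 0 < x0 \<and>
     pi_estimate_from q c x0 \<and>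
     (q > 10 ^ 5 \<longrightarrow> c = 1 / 160 \<and> x0 = exp (0.03 * sqrt (real q) * (ln (real q)) ^ 3)) \<and>
     (q \<le> 10 ^ 5 \<longrightarrow>
        c \<le> (if q \<le> 10 ^ 4 then 1 / 840 else 1 / 160) \<and>
        x0 \<le> 8 * 10 ^ 9 \<and>
        (\<forall>y>0. pi_estimate_from q c y \<longrightarrow> x0 \<le> y)) \<and>
     14735 \<le> x0"

end

(* With L = ln p, N = n * phi(q) and c * phi(q) < 1, the prime counting estimate at p = p_n(q,a)
   reads |N - Li p| < p / L^2.  Since Li p >= p / L + p / L^2, this gives N > p / L, and
   N (ln N + 4/3 ln (ln N)) increases with N and exceeds p already at N = p / L.  In the other
   direction Li p <= p / L + p / L^2 + 4.7 p / L^3 gives N < (p / L) (1 + y) with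
   y = 2 / L + 4.7 / L^2; then N ln N < p follows from ln (1 + y) <= y as soon as
   y + L y / (1 + y) < ln L, which holds for p >= 14735 with little to spare.  Both bounds
   on Li come from comparing derivatives, with numerical initial values at 4096 and 512. *)
theory Submission imports Defs begin

section \<open>Rational bounds for logarithms and exponentials\<close>

lemma le_ln_if_power_le:
  fixes x :: real
  assumes "(272 / 100) ^ m \<le> x ^ k" "x > 0" "k > 0"
  shows "real m / real k \<le> ln x"
proof -
  have "exp (real m) = exp 1 ^ m" by (simp flip: exp_of_nat_mult)
  \<comment> \<open>Replacing e by 2.72 turns a lower bound for ln x into a comparison of rational
    powers, decided by evaluation.\<close>
  also have "\<dots> \<le> (272 / 100) ^ m" using e_less_272 by (intro power_mono) auto
  also have "\<dots> \<le> x ^ k" by (rule assms)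
  finally have "real m \<le> ln (x ^ k)" using assms by (subst ln_ge_iff) auto
  then show ?thesis using assms by (simp add: ln_realpow field_simps)
qed

lemma ln2_ge: "69 / 100 \<le> ln (2::real)"
  using le_ln_if_power_le[of 69 2 100] by (simp add: power_divide)

lemma ln_14735_ge: "19 / 2 \<le> ln (14735::real)"
  using le_ln_if_power_le[of 19 14735 2] by (simp add: power_divide)

lemma ln_19_half_ge: "56 / 25 \<le> ln (19 / 2 :: real)"
  using le_ln_if_power_le[of 56 "19 / 2" 25] by (simp add: power_divide)

lemma exp_19_half_ge: "13000 \<le> exp (19 / 2 :: real)"
proof -
  \<comment> \<open>Here 19/2 = 76 * (1/8), and at 1/8 the quadratic Taylor polynomial is close
    enough to exp for its 76th power to exceed 13000.\<close>
  have "13000 \<le> (1 + 1 / 8 + (1 / 8)\<^sup>2 / 2 :: real) ^ 76" by (simp add: power2_eq_square power_divide)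
  also have "\<dots> \<le> exp (1 / 8) ^ 76" by (intro power_mono exp_lower_Taylor_quadratic) auto
  also have "\<dots> = exp (19 / 2)" by (simp flip: exp_of_nat_mult)
  finally show ?thesis .
qed

text \<open>The factor 14 serves \<open>Li_le\<close>, which needs x >= (97/7) (ln x)^3. Using exp t
  >= 1 + t at t = 2 L / 19 - 1 makes that step exact at the endpoint L = 19/2.\<close>

lemma cube_le_exp:
  fixes L :: real
  assumes "19 / 2 \<le> L"
  shows "14 * L ^ 3 \<le> exp L"
proof -
  have "2 * L / 19 \<le> exp (2 * L / 19 - 1)" using exp_ge_add_one_self[of "2 * L / 19 - 1"] by simp
  then have "(2 * L / 19) ^ 3 \<le> exp (2 * L / 19 - 1) ^ 3" using assms by (intro power_mono) auto
  also have "\<dots> = exp (6 * L / 19 - 3)" by (simp flip: exp_of_nat_mult)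
  also have "\<dots> \<le> exp (L - 19 / 2)" using assms by simp
  finally have "(2 * L / 19) ^ 3 * exp (19 / 2) \<le> exp (L - 19 / 2) * exp (19 / 2)" by simp
  also have "\<dots> = exp L" by (simp flip: exp_add)
  finally have *: "(2 * L / 19) ^ 3 * exp (19 / 2) \<le> exp L" .
  have "(2 * L / 19) ^ 3 * 13000 \<le> (2 * L / 19) ^ 3 * exp (19 / 2)"
    using assms exp_19_half_ge by (intro mult_left_mono) auto
  moreover have "14 * L ^ 3 \<le> (2 * L / 19) ^ 3 * 13000"
    using assms by (simp add: power_mult_distrib power_divide)
  ultimately show ?thesis using * by linarith
qed

section \<open>The logarithmic integral and its bounds\<close>

lemma Li_2 [simp]: "Li 2 = 0"
  by (simp add: Li_def interval_integral_endpoints_same)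

lemma DERIV_Li:
  assumes "x \<ge> 2"
  shows "(Li has_real_derivative 1 / ln x) (at x)"
proof -
  \<comment> \<open>Starting at 3/2 puts x = 2 in the interior, so the derivative there is
    two-sided.\<close>
  have "continuous_on {3/2..x + 1} (\<lambda>y. 1 / ln y :: real)" by (intro continuous_intros) auto
  then have "((\<lambda>u. LBINT y=ereal 2..ereal u. 1 / ln y) has_vector_derivative 1 / ln x) (at x within {3/2..x + 1})"
    using interval_integral_FTC2[of "3/2" 2 "x + 1" "\<lambda>y. 1 / ln y" x] assms
    by simp
  moreover have "at x within {3/2..x + 1} = at x" using assms by (intro at_within_Icc_at) auto
  ultimately show ?thesis by (simp add: Li_def[abs_def] has_real_derivative_iff_has_vector_derivative)
qed

lemma Li_diff_le:
  assumes "2 \<le> a" "a < b"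
  shows "Li b - Li a \<le> (b - a) / ln a"
proof -
  obtain z where z: "a < z" "z < b" "Li b - Li a = (b - a) * (1 / ln z)"
    using MVT2[of a b Li "\<lambda>x. 1 / ln x"] assms DERIV_Li by auto
  moreover have "ln a \<le> ln z" "0 < ln a" using assms z by auto
  ultimately show ?thesis using assms by (simp add: frac_le)
qed

text \<open>Upper Riemann sum over the dyadic intervals from 2^k to 2^(k+1), on which 1 / ln t is at
  most 1 / (k ln 2).\<close>

lemma Li_512_le: "Li 512 \<le> 1131 / 10"
proof -
  have step: "Li (2 ^ Suc k) - Li (2 ^ k) \<le> (2 ^ k / real k) / ln 2" if "k \<ge> 1" for k :: nat
  proof -
    have "(2::real) ^ 1 \<le> 2 ^ k" using that by (intro power_increasing) auto
    then show ?thesis using Li_diff_le[of "2 ^ k" "2 ^ Suc k"] by (simp add: ln_realpow)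
  qed
  have "Li 512 \<le> (\<Sum>k=1..8. 2 ^ k / real k) / ln 2"
    using step[of 1] step[of 2] step[of 3] step[of 4] step[of 5] step[of 6] step[of 7] step[of 8]
    by (simp add: numeral_eq_Suc add_divide_distrib)
  also have "(\<Sum>k=1..8. 2 ^ k / real k) = 8192 / 105"
    by (simp add: numeral_eq_Suc)
  also have "8192 / 105 / ln 2 \<le> 8192 / 105 / (69 / 100 :: real)"
    using ln2_ge by (intro divide_left_mono) auto
  finally show ?thesis by simp
qed

text \<open>In the derivative of \<open>G\<close> all terms but 2 / (ln x)^3 cancel. As
  \<open>G 2\<close> is negative, the growth of \<open>G\<close> up to 4096 must first outweigh
  it.\<close>

lemma Li_ge:
  assumes "x \<ge> 14735"
  shows "x / ln x + x / (ln x)\<^sup>2 \<le> Li x"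
proof -
  define G where "G = (\<lambda>x. Li x - x / ln x - x / (ln x)\<^sup>2)"
  have DG: "(G has_real_derivative 2 / (ln x) ^ 3) (at x)" if "x \<ge> 2" for x
  proof -
    have "ln x > 0" using that by simp
    then show ?thesis unfolding G_def using that
      by (auto intro!: derivative_eq_intros DERIV_Li simp: field_simps eval_nat_numeral)
  qed
  have "2 / ln 2 \<le> 2 / (2 / 3 :: real)" "2 / (ln 2)\<^sup>2 \<le> 2 / (2 / 3 :: real)\<^sup>2"
    using ln2_ge_two_thirds by (intro divide_left_mono power_mono; simp)+
  then have "-15/2 \<le> G 2" by (simp add: G_def power2_eq_square)
  moreover have "8 \<le> G 4096 - G 2"
  proof -
    obtain z where z: "2 < z" "z < 4096" "G 4096 - G 2 = (4096 - 2) * (2 / ln z ^ 3)"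
      using MVT2[of 2 4096 G "\<lambda>x. 2 / ln x ^ 3"] DG by auto
    have "ln z \<le> ln 4096" using z by simp
    also have "\<dots> = 12 * ln 2" using ln_realpow[of "2::real" 12] by simp
    finally have "ln z \<le> 25 / 3" using ln2_le_25_over_36 by linarith
    then have "ln z ^ 3 \<le> (25 / 3) ^ 3" using z by (intro power_mono) auto
    then have "2 / (25 / 3) ^ 3 \<le> 2 / ln z ^ 3" using z by (intro divide_left_mono) auto
    then show ?thesis using z(3) by (simp add: eval_nat_numeral)
  qed
  moreover have "G 4096 \<le> G x"
    using assms by (intro DERIV_nonneg_imp_nondecreasing[where f = G]) (auto intro!: exI[of _ "2 / ln _ ^ 3"] DG)
  ultimately show ?thesis by (simp add: G_def)
qed

text \<open>With coefficient 4 on the cubic term, \<open>F\<close> increases once ln x >= 6, which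
  holds from 512 = 2^9 on because ln 2 >= 2/3. The lower bound for \<open>F 512\<close> is negative;
  the extra 0.7 in the coefficient covers it when x >= 14735.\<close>

lemma Li_le:
  assumes "x \<ge> 14735"
  shows "Li x \<le> x / ln x + x / (ln x)\<^sup>2 + 47 / 10 * x / (ln x) ^ 3"
proof -
  define F where "F = (\<lambda>x. x / ln x + x / (ln x)\<^sup>2 + 4 * x / (ln x) ^ 3 - Li x)"
  have DF: "(F has_real_derivative (2 * ln x - 12) / (ln x) ^ 4) (at x)" if "x \<ge> 2" for x
  proof -
    have "ln x > 0" using that by simp
    then show ?thesis unfolding F_def using that
      by (auto intro!: derivative_eq_intros DERIV_Li simp: field_simps eval_nat_numeral)
  qed
  have ln512: "ln (512::real) = 9 * ln 2" using ln_realpow[of "2::real" 9] by simp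
  have "F 512 \<le> F x"
  proof (rule DERIV_nonneg_imp_nondecreasing[where f = F])
    fix t :: real assume t: "512 \<le> t" "t \<le> x"
    then have "ln 512 \<le> ln t" by simp
    then have "6 \<le> ln t" using ln512 ln2_ge_two_thirds by linarith
    then show "\<exists>y. (F has_real_derivative y) (at t) \<and> y \<ge> 0"
      using t by (intro exI[of _ "(2 * ln t - 12) / ln t ^ 4"]) (auto intro!: DF)
  qed (use assms in auto)
  moreover have "- 97 / 10 \<le> F 512"
  proof -
    have l: "0 < ln (512::real)" "ln (512::real) \<le> 25 / 4" using ln512 ln2_le_25_over_36 by auto
    have "512 / (25 / 4) \<le> 512 / ln (512::real)" "512 / (25 / 4)\<^sup>2 \<le> 512 / (ln (512::real))\<^sup>2"
      "2048 / (25 / 4) ^ 3 \<le> 2048 / (ln (512::real)) ^ 3"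
      using l by (intro divide_left_mono power_mono; simp)+
    then show ?thesis using Li_512_le by (simp add: F_def eval_nat_numeral)
  qed
  moreover have "97 / 10 \<le> 7 / 10 * x / (ln x) ^ 3"
  proof -
    have "ln 14735 \<le> ln x" using assms by simp
    then have L: "19 / 2 \<le> ln x" using ln_14735_ge by linarith
    then have "14 * ln x ^ 3 \<le> x" using cube_le_exp[of "ln x"] assms by simp
    moreover have pos: "ln x ^ 3 > 0" using L by simp
    ultimately have "97 / 10 * ln x ^ 3 \<le> 7 / 10 * x" by linarith
    then show ?thesis using pos by (subst pos_le_divide_eq)
  qed
  moreover have "4 * x / (ln x) ^ 3 + 7 / 10 * x / (ln x) ^ 3 = 47 / 10 * x / (ln x) ^ 3"
    by (simp flip: add_divide_distrib)
  ultimately show ?thesis unfolding F_def by linarith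
qed

section \<open>Counting primes in the progression\<close>

lemma card_le_enumerate:
  fixes S :: "nat set"
  assumes "infinite S"
  shows "card {x \<in> S. x \<le> enumerate S k} = Suc k"
proof -
  have "{x \<in> S. x \<le> enumerate S k} = enumerate S ` {..k}"
  proof (intro subset_antisym subsetI)
    fix x assume x: "x \<in> {x \<in> S. x \<le> enumerate S k}"
    then obtain j where "x = enumerate S j" using enumerate_Ex[OF assms, of x] by auto
    then show "x \<in> enumerate S ` {..k}" using x assms by auto
  qed (use assms in \<open>auto simp: enumerate_in_set\<close>)
  moreover have "inj_on (enumerate S) {..k}"
    using assms by (meson inj_enumerate inj_on_subset subset_UNIV)
  ultimately show ?thesis by (simp add: card_image)
qed

text \<open>Infinitude makes \<open>enumerate\<close> meaningful, and it follows from the estimate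
  itself: the error, below x / (ln x)^2, is absorbed by the second term of \<open>Li_ge\<close>, so
  finitely many primes would keep x / ln x bounded.\<close>

lemma infinite_primes_ap:
  assumes "pi_estimate_from q c x0" "coprime a (int q)" "q > 0" "c * real (totient q) < 1"
  shows "infinite (primes_ap q a)"
proof
  assume fin: "finite (primes_ap q a)"
  have phi: "real (totient q) > 0" using \<open>q > 0\<close> by simp
  define K where "K = real (card (primes_ap q a)) * real (totient q)"
  \<comment> \<open>The entry (2 K)^2 ensures K ln x <= 2 K sqrt x <= x, contradicting x / ln x <
    K.\<close>
  define x where "x = Max {x0, 14735, (2 * K)\<^sup>2}"
  have x: "x \<ge> x0" "x \<ge> 14735" "(2 * K)\<^sup>2 \<le> x" by (simp_all add: x_def)
  have L: "ln x > 0" using x by simp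
  have K0: "K \<ge> 0" by (simp add: K_def)
  have "real (prime_count_ap x q a) * real (totient q) \<le> K"
    unfolding K_def prime_count_ap_def using fin by (intro mult_right_mono of_nat_mono card_mono) auto
  moreover have "Li x / real (totient q) - real (prime_count_ap x q a) < c * (x / (ln x)\<^sup>2)"
    using assms x unfolding pi_estimate_from_def by (fastforce simp: abs_less_iff)
  then have "Li x - real (prime_count_ap x q a) * real (totient q)
      < c * real (totient q) * (x / (ln x)\<^sup>2)"
    using phi by (simp add: field_simps)
  moreover have "c * real (totient q) * (x / (ln x)\<^sup>2) \<le> 1 * (x / (ln x)\<^sup>2)"
    using assms L x by (intro mult_right_mono) auto
  ultimately have less: "x / ln x < K" using Li_ge[OF x(2)] by linarith
  have "2 * K \<le> sqrt x" using x(3) by (rule real_le_rsqrt)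
  have "ln (sqrt x) \<le> sqrt x - 1" using x by (intro ln_le_minus_one) auto
  then have "ln x \<le> 2 * sqrt x" using x by (simp add: ln_sqrt)
  then have "K * ln x \<le> K * (2 * sqrt x)" using K0 by (intro mult_left_mono) auto
  also have "\<dots> = 2 * K * sqrt x" by simp
  also have "\<dots> \<le> sqrt x * sqrt x" using \<open>2 * K \<le> sqrt x\<close> x by (intro mult_right_mono) auto
  also have "\<dots> = x" using x by simp
  finally show False using less L by (simp add: field_simps)
qed

section \<open>The inequalities between N and p\<close>

lemma mult_ln_less_if_less_Li:
  fixes p N :: real
  assumes "p \<ge> 14735" "N > 0" "N < Li p + p / (ln p)\<^sup>2"
  shows "N * ln N < p"
proof -
  define L where "L = ln p"
  define y where "y = 2 / L + 47 / 10 / L\<^sup>2"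
  have "ln 14735 \<le> ln p" using assms by simp
  then have L: "19 / 2 \<le> L" using ln_14735_ge unfolding L_def by linarith
  have y: "y > 0" using L by (simp add: y_def add_pos_pos)
  have NT: "N < p / L * (1 + y)"
  proof -
    \<comment> \<open>The term p / L^2 occurs twice: once from the bound on Li p, once from the
      error of the estimate.\<close>
    have "p / L * (1 + y) = p / L + p / L\<^sup>2 + 47 / 10 * p / L ^ 3 + p / L\<^sup>2"
      using L by (simp add: y_def field_simps eval_nat_numeral)
    then show ?thesis using assms(3) Li_le[OF assms(1)] unfolding L_def by linarith
  qed
  have "56 / 25 \<le> ln L" using L ln_19_half_ge ln_le_cancel_iff[of "19/2" L] by linarith
  \<comment> \<open>The margin is thin: at L = 19/2 the left side is about 2.2385, against 56/25 =
    2.24.\<close>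
  moreover have "y + L * y / (1 + y) < 56 / 25"
  proof -
    \<comment> \<open>\<open>u\<close> is L^2 (1 + y). Multiplying by L^2 u leaves a quartic in L,
      whose positivity is reduced degree by degree with L >= 19/2, down to 3 L > 22.09.\<close>
    define u where "u = L\<^sup>2 + 2 * L + 47 / 10"
    have u: "u > 0" using L by (simp add: u_def add_pos_pos)
    have yu: "y = (2 * L + 47 / 10) / L\<^sup>2" "1 + y = u / L\<^sup>2"
      using L by (simp_all add: y_def u_def field_simps eval_nat_numeral)
    have "19 / 2 * L \<le> L\<^sup>2" using L by (simp add: power2_eq_square)
    then have "3 \<le> 6 / 100 * L\<^sup>2 + 1828 / 1000 * L - 188 / 10" using L by linarith
    then have "3 * L \<le> (6 / 100 * L\<^sup>2 + 1828 / 1000 * L - 188 / 10) * L"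
      using L by (intro mult_right_mono) auto
    also have "\<dots> = 6 / 100 * L ^ 3 + 1828 / 1000 * L\<^sup>2 - 188 / 10 * L"
      by (simp add: algebra_simps eval_nat_numeral)
    also have "6 / 100 * L ^ 3 \<le> (24 / 100 * L - 222 / 100) * L ^ 3"
      using L by (intro mult_right_mono) auto
    finally have "0 < (24 / 100 * L - 222 / 100) * L ^ 3 + 1828 / 1000 * L\<^sup>2 - 188 / 10 * L - 2209 / 100"
      using L by simp
    also have "\<dots> = 56 / 25 * (L\<^sup>2 * u) - ((2 * L + 47 / 10) * u + L * (2 * L + 47 / 10) * L\<^sup>2)"
      by (simp add: u_def field_simps eval_nat_numeral)
    finally have "(2 * L + 47 / 10) * u + L * (2 * L + 47 / 10) * L\<^sup>2 < 56 / 25 * (L\<^sup>2 * u)"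
      by simp
    then have "((2 * L + 47 / 10) * u + L * (2 * L + 47 / 10) * L\<^sup>2) / (L\<^sup>2 * u) < 56 / 25"
      using u L by (subst pos_divide_less_eq) auto
    also have "((2 * L + 47 / 10) * u + L * (2 * L + 47 / 10) * L\<^sup>2) / (L\<^sup>2 * u) = y + L * y / (1 + y)"
    proof -
      have "L * y / (1 + y) = L * (2 * L + 47 / 10) / u"
        unfolding yu(2) unfolding yu(1) using L u by simp
      then show ?thesis using add_frac_eq[of "L\<^sup>2" u] L u unfolding yu(1) by simp
    qed
    finally show ?thesis .
  qed
  ultimately have "y + L * y / (1 + y) < ln L" by linarith
  \<comment> \<open>Clearing the denominator 1 + y gives \<open>key\<close>, the form needed once ln
    N <= L - ln L + y is known.\<close>
  then have "(y + L * y / (1 + y)) * (1 + y) < ln L * (1 + y)" using y by (intro mult_strict_right_mono) auto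
  moreover have "(y + L * y / (1 + y)) * (1 + y) = y * (1 + y) + L * y"
    using y by (simp add: distrib_right)
  ultimately have key: "(1 + y) * (L - ln L + y) < L" by (simp add: algebra_simps)
  have "ln L \<le> L - 1" using L by (intro ln_le_minus_one) auto
  \<comment> \<open>Positivity of this bound for ln N allows the other factor N to be replaced by
    its upper bound.\<close>
  then have pos: "0 < L - ln L + y" using y by linarith
  have "ln N \<le> ln (p / L * (1 + y))" using NT assms by simp
  also have "\<dots> = L - ln L + ln (1 + y)"
    using assms L y by (simp add: ln_mult ln_div L_def)
  also have "\<dots> \<le> L - ln L + y" using ln_add_one_self_le_self[of y] y by simp
  finally have "N * ln N \<le> N * (L - ln L + y)" using assms by (intro mult_left_mono) auto
  also have "\<dots> < p / L * (1 + y) * (L - ln L + y)" using NT pos by (intro mult_strict_right_mono)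
  also have "\<dots> = p / L * ((1 + y) * (L - ln L + y))" by (simp only: mult.assoc)
  also have "\<dots> < p / L * L" using key assms L by (intro mult_strict_left_mono) auto
  also have "\<dots> = p" using L by simp
  finally show ?thesis .
qed

lemma less_mult_ln_ln_if_Li_less:
  fixes p N :: real
  assumes "p \<ge> 14735" "Li p - p / (ln p)\<^sup>2 < N"
  shows "p < N * (ln N + 4 / 3 * ln (ln N))"
proof -
  define L where "L = ln p"
  have "ln 14735 \<le> ln p" using assms by simp
  then have L: "19 / 2 \<le> L" using ln_14735_ge unfolding L_def by linarith
  have NM: "p / L < N" using Li_ge[OF assms(1)] assms(2) unfolding L_def by linarith
  have M: "p / L > 0" using assms L by simp
  \<comment> \<open>The tangent to ln at 4 has slope 1/4, leaving room for ln L <= 3/10 L.\<close>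
  have "ln (L / 4) \<le> L / 4 - 1" using L by (intro ln_le_minus_one) auto
  moreover have "ln (L / 4) = ln L - 2 * ln 2" using L ln_realpow[of "2::real" 2] by (simp add: ln_div)
  ultimately have lower: "7 / 10 * L \<le> L - ln L" using L ln2_le_25_over_36 by linarith
  have lnM: "ln (p / L) = L - ln L" using assms L by (simp add: ln_div L_def)
  \<comment> \<open>The source of 4/3: for M = p / L, where ln M = L - ln L, the bound p <= M (ln M
    + 4/3 ln (ln M)) amounts to 3 ln L <= 4 ln (L - ln L).\<close>
  have "L ^ 3 \<le> (7 / 10 * L) ^ 4" using L by (simp add: eval_nat_numeral field_simps)
  also have "\<dots> \<le> (L - ln L) ^ 4" using lower L by (intro power_mono) auto
  finally have "ln (L ^ 3) \<le> ln ((L - ln L) ^ 4)" using L lower by (subst ln_le_cancel_iff) auto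
  then have "3 * ln L \<le> 4 * ln (L - ln L)" using L lower by (simp add: ln_realpow)
  then have "p / L * L \<le> p / L * (ln (p / L) + 4 / 3 * ln (ln (p / L)))"
    using M unfolding lnM by (intro mult_left_mono) auto
  moreover have "p / L * L = p" using L by simp
  moreover have "ln (p / L) < ln N" using M NM by simp
  \<comment> \<open>Beyond this point ln ln is positive and increasing.\<close>
  moreover have "1 < ln (p / L)" using lnM lower L by linarith
  ultimately have "p \<le> p / L * (ln (p / L) + 4 / 3 * ln (ln (p / L)))"
    and grow: "ln (p / L) + 4 / 3 * ln (ln (p / L)) \<le> ln N + 4 / 3 * ln (ln N)"
    and pos: "0 < ln (p / L) + 4 / 3 * ln (ln (p / L))"
    by (simp_all add: add_mono add_pos_pos)
  then have "p \<le> p / L * (ln (p / L) + 4 / 3 * ln (ln (p / L)))" by blast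
  also have "\<dots> < N * (ln (p / L) + 4 / 3 * ln (ln (p / L)))"
    using NM pos by (intro mult_strict_right_mono)
  also have "\<dots> \<le> N * (ln N + 4 / 3 * ln (ln N))"
    using grow M NM by (intro mult_left_mono) auto
  finally show ?thesis .
qed

theorem theorem1p5:
  fixes q n :: nat and a :: int and c\<^sub>\<pi> x\<^sub>\<pi> :: real
  assumes "q \<ge> 3"
    and "coprime a (int q)"
    and "pi_constants q c\<^sub>\<pi> x\<^sub>\<pi>"
    and "c\<^sub>\<pi> * real (totient q) < 1"
    and "n \<ge> 1"
  shows "real (nth_prime_ap n q a) \<le> x\<^sub>\<pi> \<or>
    (real n * real (totient q) * ln (real n * real (totient q)) < real (nth_prime_ap n q a) \<and>
     real (nth_prime_ap n q a) <
       real n * real (totient q) *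
         (ln (real n * real (totient q)) + 4 / 3 * ln (ln (real n * real (totient q)))))"
proof (subst disj_commute, rule disjCI)
  define p where "p = real (nth_prime_ap n q a)"
  define N where "N = real n * real (totient q)"
  assume "\<not> real (nth_prime_ap n q a) \<le> x\<^sub>\<pi>"
  then have px: "x\<^sub>\<pi> \<le> p" by (simp add: p_def)
  have est: "pi_estimate_from q c\<^sub>\<pi> x\<^sub>\<pi>" and "14735 \<le> x\<^sub>\<pi>"
    using assms(3) by (auto simp: pi_constants_def)
  then have p: "p \<ge> 14735" using px by simp
  have phi: "real (totient q) > 0" using assms(1) by simp
  have "infinite (primes_ap q a)" using infinite_primes_ap[OF est] assms by simp
  \<comment> \<open>The count at p includes p itself and \<open>enumerate\<close> starts at 0, so
    index n - 1 with n >= 1 gives exactly n.\<close>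
  then have "prime_count_ap p q a = n"
    using card_le_enumerate[of "primes_ap q a" "n - 1"] assms(5)
    by (simp add: prime_count_ap_def p_def nth_prime_ap_def)
  then have "\<bar>real n - Li p / real (totient q)\<bar> < c\<^sub>\<pi> * (p / (ln p)\<^sup>2)"
    using est assms(2) px unfolding pi_estimate_from_def by metis
  \<comment> \<open>After multiplication by phi(q), the hypothesis on c phi(q) leaves an error below
    p / (ln p)^2, free of q.\<close>
  then have "\<bar>real n - Li p / real (totient q)\<bar> * real (totient q)
      < c\<^sub>\<pi> * (p / (ln p)\<^sup>2) * real (totient q)"
    using phi by (intro mult_strict_right_mono)
  moreover have "\<bar>real n - Li p / real (totient q)\<bar> * real (totient q) = \<bar>N - Li p\<bar>"
    using phi by (simp add: N_def abs_mult_pos' field_simps flip: abs_mult_pos)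
  moreover have "c\<^sub>\<pi> * real (totient q) * (p / (ln p)\<^sup>2) \<le> 1 * (p / (ln p)\<^sup>2)"
    using assms(4) p by (intro mult_right_mono) auto
  ultimately have "\<bar>N - Li p\<bar> < p / (ln p)\<^sup>2" by (simp add: mult_ac)
  then have "Li p - p / (ln p)\<^sup>2 < N" "N < Li p + p / (ln p)\<^sup>2" by (auto simp: abs_less_iff)
  moreover have "N > 0" using phi assms(5) by (simp add: N_def)
  ultimately have "N * ln N < p \<and> p < N * (ln N + 4 / 3 * ln (ln N))"
    using mult_ln_less_if_less_Li[OF p] less_mult_ln_ln_if_Li_less[OF p] by blast
  then show "real n * real (totient q) * ln (real n * real (totient q)) < real (nth_prime_ap n q a) \<and>
     real (nth_prime_ap n q a) <
       real n * real (totient q) *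
         (ln (real n * real (totient q)) + 4 / 3 * ln (ln (real n * real (totient q))))"
    by (simp only: p_def N_def)
qed

end
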